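(* Let $\mathbf n\ge 3$ and let $M^{red}_{\langle\mathbf n\rangle}=M_{\langle\mathbf n\rangle}-\sum_{j=1}^{\mathbf n}x^1_{\mathbf n}\otimes y^{\mathbf n}_j\otimes z^j_1$, where $M_{\langle\mathbf n\rangle}=\sum_{i,j,k=1}^{\mathbf n}x^i_j\otimes y^j_k\otimes z^k_i\in A\otimes B\otimes C$ with $\{x^i_j\},\{y^j_k\},\{z^k_i\}$ bases of $A,B,C\cong\mathbb C^{\mathbf n^2}$. Then $\underline{\mathbf R}(M^{red}_{\langle\mathbf n\rangle})\ge 2\mathbf n^2-\mathbf n$.
   Context: The border rank $\underline{\mathbf R}(T)$ of a tensor $T$ is the smallest $r$ such that $T$ is a limit of sums of $r$ rank one tensors $a\otimes b\otimes c$. *)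

theory Defs
  imports Complex_Main
begin

text \<open>Basis index of A, B, C = C^(n^2): pairs (i,j) with i,j < n (0-based;
  paper index i corresponds to i-1 here). A tensor in A (x) B (x) C is given by
  its coordinate array on idxset n x idxset n x idxset n.\<close>

type_synonym idx = "nat \<times> nat"

definition idxset :: "nat \<Rightarrow> idx set" where
  "idxset n = {..<n} \<times> {..<n}"

definition mm_tensor :: "nat \<Rightarrow> idx \<Rightarrow> idx \<Rightarrow> idx \<Rightarrow> complex" where
  "mm_tensor n a b c =
     (\<Sum>i<n. \<Sum>j<n. \<Sum>k<n.
        (if a = (i,j) \<and> b = (j,k) \<and> c = (k,i) then 1 else 0))"

definition mm_red_tensor :: "nat \<Rightarrow> idx \<Rightarrow> idx \<Rightarrow> idx \<Rightarrow> complex" where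
  "mm_red_tensor n a b c = mm_tensor n a b c -
     (\<Sum>j<n. (if a = (0, n - 1) \<and> b = (n - 1, j) \<and> c = (j, 0) then 1 else 0))"

text \<open>T is a limit of sums of r rank-one tensors a (x) b (x) c (coordinatewise
  convergence, equivalent to convergence in any norm in finite dimension).\<close>
definition border_rank_le :: "nat \<Rightarrow> (idx \<Rightarrow> idx \<Rightarrow> idx \<Rightarrow> complex) \<Rightarrow> nat \<Rightarrow> bool" where
  "border_rank_le n T r \<longleftrightarrow>
     (\<exists>u v w :: nat \<Rightarrow> nat \<Rightarrow> idx \<Rightarrow> complex.
        \<forall>a\<in>idxset n. \<forall>b\<in>idxset n. \<forall>c\<in>idxset n.
          (\<lambda>m. \<Sum>l<r. u m l a * v m l b * w m l c) \<longlonglongrightarrow> T a b c)"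

definition border_rank :: "nat \<Rightarrow> (idx \<Rightarrow> idx \<Rightarrow> idx \<Rightarrow> complex) \<Rightarrow> nat" where
  "border_rank n T = (LEAST r. border_rank_le n T r)"

end

theory Submission
  imports Defs "HOL-Analysis.Topology_Euclidean_Space"
begin

text \<open>Project \<open>A\<close> to a space \<open>E\<close> of dimension \<open>2n - 1\<close> by sending the basis vector with (0-based)
  index \<open>(i, j)\<close> to \<open>e\<^bsub>i + j\<^esub>\<close>, and take the Koszul flattening
  \<open>\<Lambda>\<^sup>n\<^sup>-\<^sup>1E \<otimes> B\<^sup>* \<rightarrow> \<Lambda>\<^sup>nE \<otimes> C\<close>. A rank one tensor contributes rank at most
  \<open>D = binomial(2n - 2, n - 1)\<close>, and this bound passes to limits. For the full matrix multiplication
  tensor the flattening is, up to ordering, triangular and invertible of size \<open>(2n\<^sup>2 - n) D\<close>: the column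
  \<open>(S, j)\<close> has its pivot in the row \<open>(S \<union> {c}, c - j)\<close>, with \<open>c\<close> the \<open>j\<close>-th number missing from \<open>S\<close>.
  Only \<open>S = {n..<2n - 1}\<close>, \<open>j = n - 1\<close> has its pivot on the deleted entry \<open>(0, n - 1)\<close>, so at
  most \<open>n\<close> columns are lost, and \<open>n < D\<close> when \<open>n \<ge> 3\<close>.\<close>

section \<open>Homogeneous linear systems\<close>

text \<open>Gaussian elimination, one equation at a time: either equation \<open>i\<close> has only
  zero coefficients, or it is solved for an unknown \<open>q\<close>, which leaves one equation and
  one unknown fewer.\<close>

lemma homogeneous_system_nontrivial_solution:
  fixes A :: "'i \<Rightarrow> 'j \<Rightarrow> 'a::field"
  assumes "finite I" "finite J" "card I < card J"
  shows "\<exists>x. (\<exists>p\<in>J. x p \<noteq> 0) \<and> (\<forall>i\<in>I. (\<Sum>p\<in>J. A i p * x p) = 0)"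
  using assms
proof (induction I arbitrary: J A rule: finite_induct)
  case empty
  then have "J \<noteq> {}" by auto
  then show ?case by (intro exI[of _ "\<lambda>_. 1"]) auto
next
  case (insert i I)
  show ?case
  proof (cases "\<forall>p\<in>J. A i p = 0")
    case True
    have "card I < card J" using insert by simp
    from insert.IH[OF insert.prems(1) this] obtain x where
      "\<exists>p\<in>J. x p \<noteq> 0" "\<forall>i\<in>I. (\<Sum>p\<in>J. A i p * x p) = 0" by blast
    with True show ?thesis by (intro exI[of _ x]) auto
  next
    case False
    then obtain q where q: "q \<in> J" "A i q \<noteq> 0" by blast
    define J' where "J' = J - {q}"
    have J': "finite J'" "card I < card J'"
      using insert q by (auto simp: J'_def)
    have J: "J = insert q J'" "q \<notin> J'" using q by (auto simp: J'_def)
    from insert.IH[OF J', of "\<lambda>k p. A k p - A k q * A i p / A i q"] obtain x where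
      x: "\<exists>p\<in>J'. x p \<noteq> 0"
         "\<And>k. k \<in> I \<Longrightarrow> (\<Sum>p\<in>J'. (A k p - A k q * A i p / A i q) * x p) = 0" by blast
    define c where "c = - (\<Sum>p\<in>J'. A i p * x p) / A i q"
    define y where "y = x(q := c)"
    have sum_y: "(\<Sum>p\<in>J. A k p * y p) = A k q * c + (\<Sum>p\<in>J'. A k p * x p)" for k
    proof -
      have "(\<Sum>p\<in>J'. A k p * y p) = (\<Sum>p\<in>J'. A k p * x p)"
        using J(2) by (intro sum.cong) (auto simp: y_def)
      then show ?thesis using J J'(1) by (simp add: y_def)
    qed
    have "(\<Sum>p\<in>J. A k p * y p) = 0" if "k \<in> I" for k
    proof -
      have "0 = (\<Sum>p\<in>J'. A k p * x p - A k q / A i q * (A i p * x p))"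
        using x(2)[OF that] by (simp add: algebra_simps)
      also have "\<dots> = (\<Sum>p\<in>J'. A k p * x p) - A k q / A i q * (\<Sum>p\<in>J'. A i p * x p)"
        by (simp add: sum_subtractf sum_distrib_left)
      finally show ?thesis by (simp add: sum_y c_def)
    qed
    moreover have "(\<Sum>p\<in>J. A i p * y p) = 0"
      using q by (simp add: sum_y c_def)
    moreover have "\<exists>p\<in>J. y p \<noteq> 0" using x(1) J by (auto simp: y_def)
    ultimately show ?thesis by (intro exI[of _ y]) auto
  qed
qed

lemma bounded_family_convergent_subsequence:
  fixes x :: "nat \<Rightarrow> 'j \<Rightarrow> 'a::heine_borel"
  assumes "finite J" "\<And>p. p \<in> J \<Longrightarrow> bounded (range (\<lambda>m. x m p))"
  shows "\<exists>r. strict_mono (r :: nat \<Rightarrow> nat) \<and> (\<forall>p\<in>J. convergent (\<lambda>m. x (r m) p))"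
  using assms
proof (induction J rule: finite_induct)
  case empty
  show ?case by (intro exI[of _ id]) (auto simp: strict_mono_def)
next
  case (insert q J)
  then obtain r where r: "strict_mono (r :: nat \<Rightarrow> nat)" "\<forall>p\<in>J. convergent (\<lambda>m. x (r m) p)"
    by auto
  have "bounded (range (\<lambda>m. x (r m) q))"
    using insert.prems[of q] by (rule bounded_subset) auto
  then obtain l s where s: "strict_mono (s :: nat \<Rightarrow> nat)" "((\<lambda>m. x (r m) q) \<circ> s) \<longlonglongrightarrow> l"
    using bounded_imp_convergent_subsequence by blast
  have "convergent (\<lambda>m. x ((r \<circ> s) m) p)" if "p \<in> insert q J" for p
  proof (cases "p = q")
    case True
    with s(2) show ?thesis by (auto simp: convergent_def o_def)
  next
    case False
    with that r obtain L where "(\<lambda>m. x (r m) p) \<longlonglongrightarrow> L" by (auto simp: convergent_def)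
    from LIMSEQ_subseq_LIMSEQ[OF this s(1)] show ?thesis by (auto simp: convergent_def o_def)
  qed
  with strict_mono_o[OF r(1) s(1)] show ?case by blast
qed

text \<open>Kernel vectors scaled to l1 norm 1 have a convergent subsequence; its limit still has
  norm 1, and the equations pass to the limit. This plays the part of lower semicontinuity of matrix
  rank.\<close>

lemma nontrivial_kernel_limit:
  fixes A :: "nat \<Rightarrow> 'i \<Rightarrow> 'j \<Rightarrow> complex"
  assumes "finite J"
    and lim: "\<And>i p. i \<in> I \<Longrightarrow> p \<in> J \<Longrightarrow> (\<lambda>m. A m i p) \<longlonglongrightarrow> B i p"
    and ker: "\<And>m. \<exists>x. (\<exists>p\<in>J. x p \<noteq> 0) \<and> (\<forall>i\<in>I. (\<Sum>p\<in>J. A m i p * x p) = 0)"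
  shows "\<exists>x. (\<exists>p\<in>J. x p \<noteq> 0) \<and> (\<forall>i\<in>I. (\<Sum>p\<in>J. B i p * x p) = 0)"
proof -
  have "\<exists>x. (\<Sum>p\<in>J. norm (x p)) = 1 \<and> (\<forall>i\<in>I. (\<Sum>p\<in>J. A m i p * x p) = 0)" for m
  proof -
    obtain x where x: "\<exists>p\<in>J. x p \<noteq> 0" "\<forall>i\<in>I. (\<Sum>p\<in>J. A m i p * x p) = 0"
      using ker by blast
    define c where "c = (\<Sum>p\<in>J. norm (x p))"
    have c: "c > 0"
      using x(1) \<open>finite J\<close> unfolding c_def by (auto intro: sum_pos2)
    have "(\<Sum>p\<in>J. norm (x p / of_real c)) = 1"
      using c by (simp add: norm_divide flip: sum_divide_distrib c_def)
    moreover have "(\<Sum>p\<in>J. A m i p * (x p / of_real c)) = 0" if "i \<in> I" for i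
      using x(2) that by (simp flip: sum_divide_distrib)
    ultimately show ?thesis by (intro exI[of _ "\<lambda>p. x p / of_real c"]) auto
  qed
  then obtain x where x: "\<And>m. (\<Sum>p\<in>J. norm (x m p)) = 1"
    "\<And>m i. i \<in> I \<Longrightarrow> (\<Sum>p\<in>J. A m i p * x m p) = 0" by metis
  have "norm (x m p) \<le> 1" if "p \<in> J" for m p
    using member_le_sum[OF that, of "\<lambda>p. norm (x m p)"] x(1)[of m] \<open>finite J\<close> by simp
  then have bdd: "bounded (range (\<lambda>m. x m p))" if "p \<in> J" for p
    using that by (auto simp: bounded_iff)
  obtain r where
    r: "strict_mono (r :: nat \<Rightarrow> nat)" "\<forall>p\<in>J. convergent (\<lambda>m. x (r m) p)"
    using bounded_family_convergent_subsequence[of J x, OF \<open>finite J\<close> bdd] by blast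
  from r(2) obtain y where y: "\<And>p. p \<in> J \<Longrightarrow> (\<lambda>m. x (r m) p) \<longlonglongrightarrow> y p"
    unfolding convergent_def by metis
  have "(\<lambda>m. \<Sum>p\<in>J. norm (x (r m) p)) \<longlonglongrightarrow> (\<Sum>p\<in>J. norm (y p))"
    by (intro tendsto_sum tendsto_norm y)
  then have "(\<Sum>p\<in>J. norm (y p)) = 1"
    by (simp add: x(1) LIMSEQ_const_iff)
  then have "\<exists>p\<in>J. y p \<noteq> 0"
    by (metis norm_zero sum.neutral zero_neq_one)
  moreover have "(\<Sum>p\<in>J. B i p * y p) = 0" if i: "i \<in> I" for i
  proof -
    have "(\<lambda>m. A (r m) i p) \<longlonglongrightarrow> B i p" if "p \<in> J" for p
      using LIMSEQ_subseq_LIMSEQ[OF lim[OF i that] r(1)] by (simp add: o_def)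
    then have "(\<lambda>m. \<Sum>p\<in>J. A (r m) i p * x (r m) p) \<longlonglongrightarrow> (\<Sum>p\<in>J. B i p * y p)"
      by (intro tendsto_sum tendsto_mult y)
    then show ?thesis by (simp add: x(2)[OF i] LIMSEQ_const_iff)
  qed
  ultimately show ?thesis by blast
qed

section \<open>Exterior multiplication by a vector\<close>

definition wedge_sign :: "nat set \<Rightarrow> nat \<Rightarrow> complex" where
  "wedge_sign T t = (-1) ^ card {s\<in>T. s < t}"

text \<open>The coefficient of \<open>e\<^sub>T\<close> in \<open>u \<and> \<omega>\<close>, where \<open>\<omega> S\<close> is the coefficient of \<open>e\<^sub>S\<close> in \<open>\<omega>\<close>.\<close>

definition wedge :: "(nat \<Rightarrow> complex) \<Rightarrow> (nat set \<Rightarrow> complex) \<Rightarrow> nat set \<Rightarrow> complex" where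
  "wedge u \<omega> T = (\<Sum>t\<in>T. wedge_sign T t * u t * \<omega> (T - {t}))"

lemma wedge_sign_nonzero: "wedge_sign T t \<noteq> 0"
  by (simp add: wedge_sign_def)

text \<open>Removing the smaller element lowers the position of the larger by one, while removing
  the larger does not move the smaller: one extra sign.\<close>

lemma wedge_sign_antisym:
  assumes "finite T" "s \<in> T" "t \<in> T" "s \<noteq> t"
  shows "wedge_sign T t * wedge_sign (T - {t}) s = - (wedge_sign T s * wedge_sign (T - {s}) t)"
proof -
  have *: "wedge_sign T t * wedge_sign (T - {t}) s = - (wedge_sign T s * wedge_sign (T - {s}) t)"
    if "s \<in> T" "t \<in> T" "s < t" for s t
  proof -
    have "{q \<in> T - {t}. q < s} = {q \<in> T. q < s}" using that by auto
    then have 1: "wedge_sign (T - {t}) s = wedge_sign T s" by (simp add: wedge_sign_def)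
    have "{q \<in> T. q < t} = insert s {q \<in> T - {s}. q < t}" using that by auto
    then have "card {q \<in> T. q < t} = Suc (card {q \<in> T - {s}. q < t})"
      using \<open>finite T\<close> by simp
    then have 2: "wedge_sign T t = - wedge_sign (T - {s}) t" by (simp add: wedge_sign_def)
    show ?thesis by (simp add: 1 2)
  qed
  show ?thesis
    using *[of s t] *[of t s] assms by (cases "s < t") auto
qed

lemma wedge_wedge_same:
  assumes "finite T"
  shows "wedge u (wedge u \<omega>) T = 0"
proof -
  \<comment> \<open>The zero diagonal lets both sums run over all of \<open>T\<close>, so that
    swapping \<open>s\<close> and \<open>t\<close> cancels the terms in pairs.\<close>
  define F where "F t s = (if s = t then 0 else
    wedge_sign T t * wedge_sign (T - {t}) s * u t * u s * \<omega> (T - {t} - {s}))" for t s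
  have F: "F t s = - F s t" if "s \<in> T" "t \<in> T" for s t
  proof -
    have "T - {t} - {s} = T - {s} - {t}" by auto
    then show ?thesis using wedge_sign_antisym[OF assms that] by (simp add: F_def)
  qed
  have "wedge u (wedge u \<omega>) T = (\<Sum>t\<in>T. \<Sum>s\<in>T. F t s)"
  proof -
    have "wedge_sign T t * u t * wedge u \<omega> (T - {t}) = (\<Sum>s\<in>T. F t s)" if "t \<in> T" for t
    proof -
      have "(\<Sum>s\<in>T. F t s) = (\<Sum>s\<in>T - {t}. F t s)"
        using assms that by (simp add: sum.remove F_def)
      also have "\<dots> = wedge_sign T t * u t * wedge u \<omega> (T - {t})"
        unfolding wedge_def sum_distrib_left by (intro sum.cong) (auto simp: F_def)
      finally show ?thesis by simp
    qed
    then show ?thesis by (simp add: wedge_def[of u "wedge u \<omega>"])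
  qed
  moreover have "(\<Sum>t\<in>T. \<Sum>s\<in>T. F t s) = - (\<Sum>t\<in>T. \<Sum>s\<in>T. F t s)"
  proof -
    have "(\<Sum>t\<in>T. \<Sum>s\<in>T. F t s) = (\<Sum>t\<in>T. \<Sum>s\<in>T. - F s t)"
      by (intro sum.cong F) auto
    also have "\<dots> = - (\<Sum>t\<in>T. \<Sum>s\<in>T. F t s)"
      by (subst sum.swap) (simp add: sum_negf)
    finally show ?thesis .
  qed
  ultimately show ?thesis by simp
qed

text \<open>Since \<open>u \<and> (u \<and> \<omega>) = 0\<close>, the product \<open>u \<and> \<omega>\<close> is determined by its coefficients at the
  \<open>T\<close> containing a fixed \<open>k\<close> with \<open>u k \<noteq> 0\<close>. This bounds the rank of \<open>u \<and> _\<close>.\<close>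

lemma wedge_eq_0_if_vanishing_at_index:
  assumes "N > 0"
  shows "\<exists>k<N. \<forall>\<omega> d. (\<forall>T. T \<subseteq> {..<N} \<and> card T = d \<and> k \<in> T \<longrightarrow> wedge u \<omega> T = 0) \<longrightarrow>
    (\<forall>T. T \<subseteq> {..<N} \<and> card T = d \<longrightarrow> wedge u \<omega> T = 0)"
proof (cases "\<exists>k<N. u k \<noteq> 0")
  case False
  then have "wedge u \<omega> T = 0" if "T \<subseteq> {..<N}" for T \<omega>
    using that by (auto simp: wedge_def intro!: sum.neutral)
  with assms show ?thesis by blast
next
  case True
  then obtain k where k: "k < N" "u k \<noteq> 0" by blast
  have "wedge u \<omega> T = 0"
    if *: "\<And>T. T \<subseteq> {..<N} \<Longrightarrow> card T = d \<Longrightarrow> k \<in> T \<Longrightarrow> wedge u \<omega> T = 0"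
      and T: "T \<subseteq> {..<N}" "card T = d" for \<omega> d T
  proof (cases "k \<in> T")
    case True
    with * T show ?thesis by blast
  next
    case False
    have "finite T" using T(1) finite_subset by blast
    have zero: "wedge u \<omega> (insert k T - {t}) = 0" if "t \<in> T" for t
    proof (rule *)
      show "card (insert k T - {t}) = d"
        using that False \<open>finite T\<close> T(2) by (simp add: card_Diff_singleton_if)
    qed (use that False k T in auto)
    \<comment> \<open>At \<open>insert k T\<close> only the term that removes \<open>k\<close>
      survives: every other one leaves a set containing \<open>k\<close>.\<close>
    have "0 = wedge u (wedge u \<omega>) (insert k T)"
      using \<open>finite T\<close> by (simp add: wedge_wedge_same)
    also have "\<dots> = wedge_sign (insert k T) k * u k * wedge u \<omega> T"
      unfolding wedge_def[of u "wedge u \<omega>"] using \<open>finite T\<close> False by (simp add: zero)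
    finally show ?thesis using k by (simp add: wedge_sign_nonzero)
  qed
  note main = this
  show ?thesis
  proof (intro exI[of _ k] conjI allI impI)
    fix \<omega> d T
    assume "\<forall>T. T \<subseteq> {..<N} \<and> card T = d \<and> k \<in> T \<longrightarrow> wedge u \<omega> T = 0"
      and "T \<subseteq> {..<N} \<and> card T = d"
    then show "wedge u \<omega> T = 0" by (intro main[of d \<omega> T]) auto
  qed (rule k(1))
qed

section \<open>The triangular structure of the flattening\<close>

text \<open>\<open>matched S j i\<close> says that \<open>i + j\<close> is the \<open>j\<close>-th element missing from \<open>S\<close>; equivalently,
  it becomes the \<open>i\<close>-th element of \<open>insert (i + j) S\<close> (both counted from 0).\<close>

definition matched :: "nat set \<Rightarrow> nat \<Rightarrow> nat \<Rightarrow> bool" where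
  "matched S j i \<longleftrightarrow> i + j \<notin> S \<and> card {s\<in>S. s < i + j} = i"

text \<open>Discrete intermediate values: with \<open>c t\<close> elements of \<open>S\<close> below
  \<open>t\<close>, the quantity \<open>j + c t - t\<close> starts at \<open>j\<close>, drops by at
  most 1 per step and ends negative. Just before it turns negative it is 0, at some
  \<open>t'\<close> outside \<open>S\<close>; then \<open>i = c t'\<close>.\<close>

lemma matched_exists:
  assumes S: "S \<subseteq> {..<2 * n - 1}" "card S = n - 1" and "j < n"
  shows "\<exists>i<n. matched S j i"
proof -
  define c where "c t = card {s\<in>S. s < t}" for t
  have "finite S" using S(1) finite_subset by blast
  have c_le: "c t \<le> n - 1" for t
    unfolding c_def S(2)[symmetric] using \<open>finite S\<close> by (intro card_mono) auto
  have c_Suc: "c (Suc t) = (if t \<in> S then Suc (c t) else c t)" for t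
  proof (cases "t \<in> S")
    case True
    then have "{s\<in>S. s < Suc t} = insert t {s\<in>S. s < t}" by auto
    with True \<open>finite S\<close> show ?thesis by (simp add: c_def)
  next
    case False
    then have "{s\<in>S. s < Suc t} = {s\<in>S. s < t}" by (auto simp: less_Suc_eq)
    with False show ?thesis by (simp add: c_def)
  qed
  define t where "t = (LEAST t. j + c t < t)"
  have "j + c (2 * n) < 2 * n" using c_le[of "2 * n"] \<open>j < n\<close> by simp
  then have t: "j + c t < t" unfolding t_def by (rule LeastI)
  then obtain t' where t': "t = Suc t'" by (cases t) auto
  then have "\<not> j + c t' < t'" unfolding t_def by (metis lessI not_less_Least)
  with t t' c_Suc[of t'] have "t' \<notin> S" "j + c t' = t'" by (auto split: if_splits)
  then have "matched S j (c t')" by (simp add: matched_def c_def add.commute)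
  moreover have "c t' < n" using c_le[of t'] \<open>j < n\<close> by simp
  ultimately show ?thesis by blast
qed

text \<open>Exactly \<open>i\<close> elements lie below the pivot \<open>i + j\<close>, so it is the
  \<open>i\<close>-th element of the enlarged set, counted from 0. Distinct columns thus have
  distinct pivot rows.\<close>

lemma matched_inj:
  assumes "finite S" "finite S'" "matched S j i" "matched S' j' i"
    and eq: "insert (i + j) S = insert (i + j') S'"
  shows "S = S' \<and> j = j'"
proof -
  have *: False if "finite S'" "matched S j i" "matched S' j' i"
    "insert (i + j) S = insert (i + j') S'" "j < j'" for S S' j j'
  proof -
    have "{s\<in>S. s < i + j} \<subset> {s\<in>S'. s < i + j'}"
    proof
      show "{s\<in>S. s < i + j} \<subseteq> {s\<in>S'. s < i + j'}" using that(4,5) by auto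
      have "i + j \<in> {s\<in>S'. s < i + j'}" using that(4,5) by auto
      moreover have "i + j \<notin> {s\<in>S. s < i + j}" by simp
      ultimately show "{s\<in>S. s < i + j} \<noteq> {s\<in>S'. s < i + j'}" by metis
    qed
    then have "card {s\<in>S. s < i + j} < card {s\<in>S'. s < i + j'}"
      using that(1) by (intro psubset_card_mono) auto
    with that(2,3) show False by (simp add: matched_def)
  qed
  have "j = j'"
    using *[of S' S j j'] *[of S S' j' j] assms by (metis linorder_neqE_nat)
  moreover have "i + j \<notin> S" "i + j' \<notin> S'" using assms(3,4) by (auto simp: matched_def)
  ultimately show ?thesis using eq by (metis insert_ident)
qed

text \<open>The order that makes the flattening triangular. As a function of the row index \<open>i\<close>, the
  potential of \<open>(insert (i + j) S, i)\<close> is discretely concave, with its strict maximum at the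
  matched \<open>i\<close>.\<close>

definition potential :: "nat set \<Rightarrow> nat \<Rightarrow> int" where
  "potential T i = (\<Sum>s\<in>T. \<Sum>t\<in>T. int (max s t)) - (\<Sum>t\<in>T. int t) - (int i)\<^sup>2"

lemma potential_insert:
  assumes "finite S" "t \<notin> S"
  shows "potential (insert t S) i = potential S 0 + 2 * (\<Sum>s\<in>S. int (max s t)) - (int i)\<^sup>2"
proof -
  have "(\<Sum>s\<in>S. int (max t s)) = (\<Sum>s\<in>S. int (max s t))" by (simp add: max.commute)
  then show ?thesis
    using assms by (simp add: potential_def sum.distrib)
qed

text \<open>The part of \<open>potential (insert (i + j) S) i\<close> that varies with
  \<open>i\<close>, extended to \<open>i + j \<in> S\<close> so that consecutive \<open>i\<close>
  can always be compared.\<close>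

definition profile :: "nat set \<Rightarrow> nat \<Rightarrow> nat \<Rightarrow> int" where
  "profile S j i = 2 * (\<Sum>s\<in>S. int (max s (i + j))) - (int i)\<^sup>2"

lemma profile_Suc:
  assumes "finite S"
  shows "profile S j (Suc i) = profile S j i + 2 * int (card {s\<in>S. s \<le> i + j}) - 2 * int i - 1"
proof -
  have "(\<Sum>s\<in>S. int (max s (Suc i + j))) = (\<Sum>s\<in>S. int (max s (i + j)) + (if s \<le> i + j then 1 else 0))"
    by (intro sum.cong) auto
  also have "\<dots> = (\<Sum>s\<in>S. int (max s (i + j))) + int (card {s\<in>S. s \<le> i + j})"
    using assms(1) by (simp add: sum.distrib flip: sum.inter_filter)
  finally show ?thesis by (simp add: profile_def power2_eq_square algebra_simps)
qed

text \<open>The increment at \<open>m\<close> is \<open>2 * (c - m) - 1\<close>, where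
  \<open>c\<close> counts the elements of \<open>S\<close> up to \<open>m + j\<close>. Since
  \<open>i\<close> elements lie below \<open>i + j\<close>, counting along the interval between
  gives \<open>c > m\<close> for \<open>m < i\<close> and \<open>c \<le> m\<close> for
  \<open>m \<ge> i\<close>.\<close>

lemma profile_less_matched:
  assumes "finite S" "matched S j i" "i' \<noteq> i"
  shows "profile S j i' < profile S j i"
proof -
  let ?f = "profile S j"
  note step = profile_Suc[OF assms(1)]
  have m: "i + j \<notin> S" "card {s\<in>S. s < i + j} = i" using assms(2) by (auto simp: matched_def)
  have down: "?f (Suc m) < ?f m" if "i \<le> m" for m
  proof -
    have "{s\<in>S. s \<le> m + j} \<subseteq> {s\<in>S. s < i + j} \<union> {i + j<..m + j}" using m(1)
      by (auto simp: not_less intro: le_neq_trans)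
    then have "card {s\<in>S. s \<le> m + j} \<le> card ({s\<in>S. s < i + j} \<union> {i + j<..m + j})"
      using assms(1) by (intro card_mono) auto
    also have "\<dots> \<le> card {s\<in>S. s < i + j} + card {i + j<..m + j}" by (rule card_Un_le)
    also have "\<dots> = m" using m(2) that by simp
    finally show ?thesis by (simp add: step)
  qed
  have up: "?f m < ?f (Suc m)" if "m < i" for m
  proof -
    have "{s\<in>S. s < i + j} \<subseteq> {s\<in>S. s \<le> m + j} \<union> {m + j<..<i + j}" by auto
    then have "card {s\<in>S. s < i + j} \<le> card ({s\<in>S. s \<le> m + j} \<union> {m + j<..<i + j})"
      using assms(1) by (intro card_mono) auto
    also have "\<dots> \<le> card {s\<in>S. s \<le> m + j} + card {m + j<..<i + j}" by (rule card_Un_le)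
    finally have "m < card {s\<in>S. s \<le> m + j}" using m(2) that by simp
    then show ?thesis by (simp add: step)
  qed
  show ?thesis
  proof (cases "i < i'")
    case True
    have "?f (i + Suc d) < ?f i" for d
    proof (induction d)
      case 0
      then show ?case using down[of i] by simp
    next
      case (Suc d)
      then show ?case using down[of "i + Suc d"] by simp
    qed
    from this[of "i' - Suc i"] True show ?thesis by simp
  next
    case False
    then have "i' < i" using assms(3) by simp
    then show ?thesis
    proof (induction rule: strict_inc_induct)
      case (base m)
      then show ?case using up[of m] by simp
    next
      case (step m)
      then show ?case using up[of m] by simp
    qed
  qed
qed

lemma potential_less_matched:
  assumes "finite S" "matched S j i" "i' + j \<notin> S" "i' \<noteq> i"
  shows "potential (insert (i' + j) S) i' < potential (insert (i + j) S) i"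
  using profile_less_matched[OF assms(1,2,4)] assms by (simp add: potential_insert profile_def matched_def)

section \<open>The Koszul flattening\<close>

text \<open>The flattening of \<open>\<tau> \<in> E \<otimes> B \<otimes> C\<close> maps \<open>\<Lambda>\<^sup>pE \<otimes> B\<^sup>*\<close> to \<open>\<Lambda>\<^sup>p\<^sup>+\<^sup>1E \<otimes> C\<close>; rows are indexed
  by \<open>(T, \<gamma>)\<close> and columns by \<open>(S, \<beta>)\<close>.\<close>

definition koszul :: "(nat \<Rightarrow> idx \<Rightarrow> idx \<Rightarrow> complex) \<Rightarrow> nat set \<times> idx \<Rightarrow> nat set \<times> idx \<Rightarrow> complex" where
  "koszul \<tau> R P = (\<Sum>t\<in>fst R. if fst P = fst R - {t}
     then wedge_sign (fst R) t * \<tau> t (snd P) (snd R) else 0)"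

text \<open>The projection \<open>A \<rightarrow> E\<close> that sends the basis vector with index \<open>(i, j)\<close> to \<open>e\<^bsub>i + j\<^esub>\<close>.\<close>

definition hankel :: "nat \<Rightarrow> (idx \<Rightarrow> complex) \<Rightarrow> nat \<Rightarrow> complex" where
  "hankel n f t = (\<Sum>a\<in>{a\<in>idxset n. fst a + snd a = t}. f a)"

lemma finite_idxset [simp]: "finite (idxset n)"
  by (simp add: idxset_def)

text \<open>A rank one term acts by contraction with \<open>v l\<close>, exterior multiplication by
  \<open>U l\<close> and tensoring with \<open>w l\<close>.\<close>

lemma koszul_sum_rank_one:
  "(\<Sum>P\<in>J. koszul (\<lambda>t \<beta> \<gamma>. \<Sum>l<r. U l t * v l \<beta> * w l \<gamma>) R P * x P) =
    (\<Sum>l<r. w l (snd R) *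
      wedge (U l) (\<lambda>S. \<Sum>P\<in>J. if fst P = S then v l (snd P) * x P else 0) (fst R))"
proof -
  have "(\<Sum>P\<in>J. koszul (\<lambda>t \<beta> \<gamma>. \<Sum>l<r. U l t * v l \<beta> * w l \<gamma>) R P * x P) =
    (\<Sum>P\<in>J. \<Sum>t\<in>fst R. \<Sum>l<r. w l (snd R) * (wedge_sign (fst R) t * U l t *
       (if fst P = fst R - {t} then v l (snd P) * x P else 0)))"
    unfolding koszul_def sum_distrib_right
    by (intro sum.cong refl) (auto simp: sum_distrib_left sum_distrib_right algebra_simps intro!: sum.cong)
  also have "\<dots> = (\<Sum>P\<in>J. \<Sum>l<r. \<Sum>t\<in>fst R. w l (snd R) * (wedge_sign (fst R) t * U l t *
       (if fst P = fst R - {t} then v l (snd P) * x P else 0)))"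
    by (intro sum.cong refl sum.swap)
  also have "\<dots> = (\<Sum>l<r. \<Sum>P\<in>J. \<Sum>t\<in>fst R. w l (snd R) * (wedge_sign (fst R) t * U l t *
       (if fst P = fst R - {t} then v l (snd P) * x P else 0)))"
    by (rule sum.swap)
  also have "\<dots> = (\<Sum>l<r. \<Sum>t\<in>fst R. \<Sum>P\<in>J. w l (snd R) * (wedge_sign (fst R) t * U l t *
       (if fst P = fst R - {t} then v l (snd P) * x P else 0)))"
    by (intro sum.cong refl sum.swap)
  also have "\<dots> = (\<Sum>l<r. w l (snd R) *
      wedge (U l) (\<lambda>S. \<Sum>P\<in>J. if fst P = S then v l (snd P) * x P else 0) (fst R))"
    unfolding wedge_def sum_distrib_left by simp
  finally show ?thesis .
qed

text \<open>Term \<open>l\<close> vanishes once its wedge vanishes at the sets \<open>T\<close>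
  containing \<open>k l\<close>, which costs at most \<open>N - 1 choose d\<close> equations. The
  index of \<open>C\<close> costs none, as \<open>w l\<close> is only a scalar factor.\<close>

lemma koszul_rank_one_sum_kernel:
  assumes "finite J" "N > 0" "r * (N - 1 choose d) < card J"
  shows "\<exists>x. (\<exists>P\<in>J. x P \<noteq> 0) \<and> (\<forall>R\<in>{T. T \<subseteq> {..<N} \<and> card T = Suc d} \<times> UNIV.
    (\<Sum>P\<in>J. koszul (\<lambda>t \<beta> \<gamma>. \<Sum>l<r. U l t * v l \<beta> * w l \<gamma>) R P * x P) = 0)"
proof -
  obtain k where k: "\<And>l. k l < N" "\<And>l \<omega> d T.
      (\<And>T. T \<subseteq> {..<N} \<Longrightarrow> card T = d \<Longrightarrow> k l \<in> T \<Longrightarrow> wedge (U l) \<omega> T = 0) \<Longrightarrow>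
      T \<subseteq> {..<N} \<Longrightarrow> card T = d \<Longrightarrow> wedge (U l) \<omega> T = 0"
    using wedge_eq_0_if_vanishing_at_index[OF \<open>N > 0\<close>, of "U _"] by metis
  define X where "X l = {T. T \<subseteq> {..<N} \<and> card T = Suc d \<and> k l \<in> T}" for l
  have card_X: "finite (X l) \<and> card (X l) \<le> (N - 1 choose d)" for l
  proof -
    let ?Y = "{T. T \<subseteq> {..<N} - {k l} \<and> card T = d}"
    have fin: "finite ?Y" by simp
    have "X l \<subseteq> insert (k l) ` ?Y"
    proof
      fix T assume T: "T \<in> X l"
      then have "T = insert (k l) (T - {k l})" "T - {k l} \<in> ?Y" by (auto simp: X_def)
      then show "T \<in> insert (k l) ` ?Y" by blast
    qed
    moreover have "card (insert (k l) ` ?Y) \<le> card ?Y" using fin by (rule card_image_le)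
    moreover have "card ?Y = N - 1 choose d" using k(1)[of l] by (simp add: n_subsets)
    ultimately show ?thesis using fin
      by (metis (no_types, lifting) card_mono finite_imageI finite_subset le_trans)
  qed
  define I where "I = Sigma {..<r} X"
  have "finite I" using card_X by (auto simp: I_def)
  have "card I = (\<Sum>l<r. card (X l))" using card_X by (simp add: I_def)
  also have "\<dots> \<le> (\<Sum>l<r. N - 1 choose d)" using card_X by (intro sum_mono) auto
  also have "\<dots> < card J" using assms(3) by simp
  finally have "card I < card J" .
  \<comment> \<open>Row \<open>(l, T)\<close> reads off the coefficient at \<open>T\<close> of
    \<open>U l\<close> wedged with the contraction of the unknown by \<open>v l\<close>.\<close>
  define B where "B = (\<lambda>(l, T) P. \<Sum>t\<in>T. wedge_sign T t * U l t *
    (if fst P = T - {t} then v l (snd P) else 0))"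
  obtain x where x: "\<exists>P\<in>J. x P \<noteq> 0" "\<forall>i\<in>I. (\<Sum>P\<in>J. B i P * x P) = 0"
    using homogeneous_system_nontrivial_solution[OF \<open>finite I\<close> \<open>finite J\<close> \<open>card I < card J\<close>]
    by blast
  define \<omega> where "\<omega> l = (\<lambda>S. \<Sum>P\<in>J. if fst P = S then v l (snd P) * x P else 0)" for l
  have B: "(\<Sum>P\<in>J. B (l, T) P * x P) = wedge (U l) (\<omega> l) T" for l T
  proof -
    have "(\<Sum>P\<in>J. B (l, T) P * x P) = (\<Sum>P\<in>J. \<Sum>t\<in>T. wedge_sign T t * U l t *
       (if fst P = T - {t} then v l (snd P) * x P else 0))"
      unfolding B_def by (auto simp: sum_distrib_right intro!: sum.cong)
    also have "\<dots> = (\<Sum>t\<in>T. \<Sum>P\<in>J. wedge_sign T t * U l t *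
       (if fst P = T - {t} then v l (snd P) * x P else 0))"
      by (rule sum.swap)
    finally show ?thesis by (simp add: wedge_def \<omega>_def sum_distrib_left)
  qed
  have "wedge (U l) (\<omega> l) T = 0" if "l < r" "T \<subseteq> {..<N}" "card T = Suc d" for l T
  proof (rule k(2)[OF _ that(2,3)])
    fix T assume "T \<subseteq> {..<N}" "card T = Suc d" "k l \<in> T"
    then have "(l, T) \<in> I" using that(1) by (simp add: I_def X_def)
    with x(2) B show "wedge (U l) (\<omega> l) T = 0" by metis
  qed
  then have "\<forall>R\<in>{T. T \<subseteq> {..<N} \<and> card T = Suc d} \<times> UNIV.
    (\<Sum>P\<in>J. koszul (\<lambda>t \<beta> \<gamma>. \<Sum>l<r. U l t * v l \<beta> * w l \<gamma>) R P * x P) = 0"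
    by (auto simp: koszul_sum_rank_one simp flip: \<omega>_def)
  with x(1) show ?thesis by blast
qed

section \<open>The reduced matrix multiplication tensor\<close>

lemma mm_red_tensor_eq:
  assumes "i < n" "j < n" "k < n"
  shows "mm_red_tensor n a (j, k') (k, i) =
    (if a = (i, j) \<and> k' = k \<and> \<not> (i = 0 \<and> j = n - 1) then 1 else 0)"
proof -
  have "mm_tensor n a (j, k') (k, i) =
    (\<Sum>i'<n. \<Sum>j'<n. \<Sum>l<n. if l = k then if j' = j then if i' = i then
      if a = (i, j) \<and> k' = k then 1 else 0 else 0 else 0 else 0)"
    unfolding mm_tensor_def by (intro sum.cong) auto
  also have "\<dots> = (if a = (i, j) \<and> k' = k then 1 else 0)"
    using assms by simp
  finally have 1: "mm_tensor n a (j, k') (k, i) = (if a = (i, j) \<and> k' = k then 1 else 0)" .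
  have "(\<Sum>l<n. (if a = (0, n - 1) \<and> (j, k') = (n - 1, l) \<and> (k, i) = (l, 0) then 1 else 0)) =
    (\<Sum>l<n. if l = k then if a = (i, j) \<and> k' = k \<and> i = 0 \<and> j = n - 1 then 1 else 0 else (0::complex))"
    by (intro sum.cong) auto
  also have "\<dots> = (if a = (i, j) \<and> k' = k \<and> i = 0 \<and> j = n - 1 then 1 else 0)"
    using assms by simp
  finally show ?thesis unfolding mm_red_tensor_def 1 by auto
qed

text \<open>The index \<open>k\<close> is passive: the flattening splits into \<open>n\<close> equal
  blocks, and column \<open>(S, j)\<close> meets row \<open>(T, i)\<close> only if \<open>T\<close>
  is \<open>S\<close> with the new element \<open>i + j\<close>.\<close>

lemma hankel_mm_red_tensor:
  assumes "i < n" "j < n" "k < n"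
  shows "hankel n (\<lambda>a. mm_red_tensor n a (j, k') (k, i)) t =
    (if t = i + j \<and> k' = k \<and> \<not> (i = 0 \<and> j = n - 1) then 1 else 0)"
proof -
  have "hankel n (\<lambda>a. mm_red_tensor n a (j, k') (k, i)) t =
    (\<Sum>a\<in>{a\<in>idxset n. fst a + snd a = t}.
      if a = (i, j) then if k' = k \<and> \<not> (i = 0 \<and> j = n - 1) then 1 else 0 else 0)"
    unfolding hankel_def mm_red_tensor_eq[OF assms] by (intro sum.cong) auto
  also have "\<dots> = (if t = i + j \<and> k' = k \<and> \<not> (i = 0 \<and> j = n - 1) then 1 else 0)"
    using assms by (subst sum.delta) (auto simp: idxset_def)
  finally show ?thesis .
qed

text \<open>The columns whose matched pivot is not in the deleted corner: \<open>matched S (n - 1) 0\<close> holds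
  only for \<open>S = {n..<2 * n - 1}\<close>.\<close>

definition pivot_columns :: "nat \<Rightarrow> (nat set \<times> idx) set" where
  "pivot_columns n = {S. S \<subseteq> {..<2 * n - 1} \<and> card S = n - 1} \<times> idxset n
     - {{n..<2 * n - 1}} \<times> ({n - 1} \<times> {..<n})"

lemma finite_pivot_columns: "finite (pivot_columns n)"
  by (simp add: pivot_columns_def)

lemma card_pivot_columns:
  assumes "n > 0"
  shows "card (pivot_columns n) = (2 * n\<^sup>2 - n) * (2 * n - 2 choose (n - 1)) - n"
proof -
  let ?\<S> = "{S. S \<subseteq> {..<2 * n - 1} \<and> card S = n - 1}"
  have "{{n..<2 * n - 1}} \<times> ({n - 1} \<times> {..<n}) \<subseteq> ?\<S> \<times> idxset n"
    using assms by (auto simp: idxset_def)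
  then have "card (pivot_columns n) =
      card (?\<S> \<times> idxset n) - card ({{n..<2 * n - 1}} \<times> ({n - 1} \<times> {..<n}))"
    unfolding pivot_columns_def by (intro card_Diff_subset) auto
  also have "card (?\<S> \<times> idxset n) = (2 * n - 1 choose (n - 1)) * (n * n)"
    by (simp add: card_cartesian_product n_subsets idxset_def)
  \<comment> \<open>In this form absorption can trade one factor \<open>n\<close> for
    \<open>2 * n - 1\<close>.\<close>
  also have "2 * n - 1 choose (n - 1) = 2 * n - 1 choose n"
    using assms binomial_symmetric[of n "2 * n - 1"] by (simp add: mult_2)
  also have "n * (2 * n - 1 choose n) = (2 * n - 1) * (2 * n - 2 choose (n - 1))"
    using binomial_absorption[of "n - 1" "2 * n - 1"] assms by (simp add: numeral_2_eq_2)
  then have "(2 * n - 1 choose n) * (n * n) = (2 * n\<^sup>2 - n) * (2 * n - 2 choose (n - 1))"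
    by (simp add: power2_eq_square algebra_simps)
  finally show ?thesis by (simp add: card_cartesian_product)
qed

lemma pivot_columns_pivot:
  assumes "(S, j, k) \<in> pivot_columns n"
  shows "\<exists>i<n. matched S j i \<and> \<not> (i = 0 \<and> j = n - 1)"
proof -
  have S: "S \<subseteq> {..<2 * n - 1}" "card S = n - 1" "j < n" "k < n"
    using assms by (auto simp: pivot_columns_def idxset_def)
  obtain i where i: "i < n" "matched S j i" using matched_exists[OF S(1-3)] by blast
  moreover have False if "i = 0" "j = n - 1"
  proof -
    have "finite S" using S(1) finite_subset by blast
    \<comment> \<open>No element of \<open>S\<close> lies below \<open>n\<close>, so
      \<open>S\<close> must fill all \<open>n - 1\<close> remaining places.\<close>
    then have "{s\<in>S. s < n - 1} = {}" "n - 1 \<notin> S"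
      using i(2) that by (auto simp: matched_def)
    then have "s \<ge> n" if "s \<in> S" for s
      using that by (cases "s < n - 1"; cases "s = n - 1") auto
    then have "S \<subseteq> {n..<2 * n - 1}" using S(1) by auto
    then have "S = {n..<2 * n - 1}" using S(2) by (intro card_subset_eq) auto
    with assms that S show False by (auto simp: pivot_columns_def)
  qed
  ultimately show ?thesis by blast
qed

text \<open>Among the columns in the support of \<open>x\<close>, take one whose pivot row has
  maximal potential. Another supported column meeting that row has its own pivot at strictly larger
  potential, or the same pivot row; the first contradicts maximality, the second
  \<open>matched_inj\<close>. So the row equation reduces to a sign times one coefficient.\<close>

lemma koszul_mm_red_tensor_injective:
  assumes zero: "\<And>R. R \<in> {T. T \<subseteq> {..<2 * n - 1} \<and> card T = n} \<times> idxset n \<Longrightarrow>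
      (\<Sum>P\<in>pivot_columns n.
        koszul (\<lambda>t \<beta> \<gamma>. hankel n (\<lambda>a. mm_red_tensor n a \<beta> \<gamma>) t) R P * x P) = 0"
    and "P \<in> pivot_columns n"
  shows "x P = 0"
proof (rule ccontr)
  assume "x P \<noteq> 0"
  let ?J = "pivot_columns n"
  let ?K = "koszul (\<lambda>t \<beta> \<gamma>. hankel n (\<lambda>a. mm_red_tensor n a \<beta> \<gamma>) t)"
  have "\<forall>P\<in>?J. \<exists>i<n. matched (fst P) (fst (snd P)) i \<and> \<not> (i = 0 \<and> fst (snd P) = n - 1)"
    using pivot_columns_pivot by force
  then obtain \<iota> where \<iota>: "\<And>P. P \<in> ?J \<Longrightarrow> \<iota> P < n"
    "\<And>P. P \<in> ?J \<Longrightarrow> matched (fst P) (fst (snd P)) (\<iota> P)"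
    "\<And>P. P \<in> ?J \<Longrightarrow> \<not> (\<iota> P = 0 \<and> fst (snd P) = n - 1)" by metis
  define Q where "Q P = potential (insert (\<iota> P + fst (snd P)) (fst P)) (\<iota> P)" for P
  define Z where "Z = {P\<in>?J. x P \<noteq> 0}"
  have "finite Z" by (simp add: Z_def finite_pivot_columns)
  moreover have "P \<in> Z" using assms(2) \<open>x P \<noteq> 0\<close> by (simp add: Z_def)
  ultimately obtain P\<^sub>0 where P0: "P\<^sub>0 \<in> Z" "\<And>P. P \<in> Z \<Longrightarrow> Q P \<le> Q P\<^sub>0"
    using obtains_MAX[of Z Q] Max_ge[of "Q ` Z"] by (metis empty_iff finite_imageI imageI)
  obtain S j k where Sjk: "P\<^sub>0 = (S, j, k)" by (cases P\<^sub>0)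
  have mem: "(S, j, k) \<in> ?J" using P0 Sjk by (simp add: Z_def)
  then have S: "S \<subseteq> {..<2 * n - 1}" "card S = n - 1" "j < n" "k < n"
    by (auto simp: pivot_columns_def idxset_def)
  have "finite S" using S(1) finite_subset by blast
  define i where "i = \<iota> (S, j, k)"
  have i: "i < n" "matched S j i" "\<not> (i = 0 \<and> j = n - 1)"
    using \<iota>[OF mem] by (auto simp: i_def)
  have "i + j \<notin> S" using i(2) by (simp add: matched_def)
  define R where "R = (insert (i + j) S, (k, i))"
  have "R \<in> {T. T \<subseteq> {..<2 * n - 1} \<and> card T = n} \<times> idxset n"
    using S i \<open>finite S\<close> \<open>i + j \<notin> S\<close> by (auto simp: R_def idxset_def)
  then have "0 = (\<Sum>P\<in>?J. ?K R P * x P)" by (simp add: zero)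
  also have "\<dots> = (\<Sum>P\<in>?J. if P = P\<^sub>0 then ?K R P * x P else 0)"
  proof (rule sum.cong[OF refl])
    fix P assume P: "P \<in> ?J"
    obtain S' j' k' where P_eq: "P = (S', j', k')" by (cases P)
    have S': "finite S'" "j' < n" "k' < n" using P P_eq finite_subset
      by (auto simp: pivot_columns_def idxset_def)
    show "?K R P * x P = (if P = P\<^sub>0 then ?K R P * x P else 0)"
    proof (rule ccontr)
      assume "\<not> ?thesis"
      then have ne: "P \<noteq> P\<^sub>0" "?K R P \<noteq> 0" "x P \<noteq> 0" by (auto split: if_splits)
      from ne(2) have "\<exists>t\<in>insert (i + j) S. (if S' = insert (i + j) S - {t}
          then wedge_sign (insert (i + j) S) t * hankel n (\<lambda>a. mm_red_tensor n a (j', k') (k, i)) t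
          else 0) \<noteq> 0"
        unfolding koszul_def R_def P_eq fst_conv snd_conv
        by (rule sum.not_neutral_contains_not_neutral) blast
      then obtain t where "t \<in> insert (i + j) S" "S' = insert (i + j) S - {t}"
        "hankel n (\<lambda>a. mm_red_tensor n a (j', k') (k, i)) t \<noteq> 0"
        by (metis mult_zero_right)
      then have t: "t \<in> insert (i + j) S" "S' = insert (i + j) S - {t}" "t = i + j'" "k' = k"
        using hankel_mm_red_tensor[OF i(1) S'(2) S(4), of k' t] by (auto split: if_splits)
      then have T: "insert (i + j') S' = insert (i + j) S" "i + j' \<notin> S'" by auto
      have m: "matched S' j' (\<iota> P)" using \<iota>(2)[OF P] by (simp add: P_eq)
      have "Q P \<le> Q P\<^sub>0" using P ne(3) by (intro P0) (simp add: Z_def)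
      then have "potential (insert (\<iota> P + j') S') (\<iota> P) \<le> potential (insert (i + j') S') i"
        by (simp add: Q_def Sjk P_eq T flip: i_def)
      with potential_less_matched[OF S'(1) m T(2)] have "\<iota> P = i" by force
      with m have "S = S' \<and> j = j'"
        using T(1) by (intro matched_inj[OF \<open>finite S\<close> S'(1) i(2)]) auto
      with ne(1) t(4) show False by (simp add: P_eq Sjk)
    qed
  qed
  also have "\<dots> = ?K R P\<^sub>0 * x P\<^sub>0"
    using mem by (simp add: Sjk finite_pivot_columns)
  finally have "?K R P\<^sub>0 = 0" using P0(1) by (simp add: Z_def)
  moreover have "?K R P\<^sub>0 = wedge_sign (insert (i + j) S) (i + j)"
  proof -
    have "?K R P\<^sub>0 = (\<Sum>t\<in>insert (i + j) S. if t = i + j then wedge_sign (insert (i + j) S) t else 0)"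
      unfolding koszul_def R_def Sjk using i \<open>i + j \<notin> S\<close>
      by (intro sum.cong refl) (auto simp: hankel_mm_red_tensor[OF i(1) S(3,4)])
    then show ?thesis using \<open>finite S\<close> by simp
  qed
  ultimately show False by (simp add: wedge_sign_nonzero)
qed

text \<open>If \<open>r < 2 * n\<^sup>2 - n\<close>, then \<open>r * D\<close> falls short of
  \<open>(2 * n\<^sup>2 - n) * D\<close> by at least \<open>D > n\<close>, so it is less than the
  number of pivot columns. Every approximating flattening then has a kernel on these columns, and so
  has the limit, against injectivity.\<close>

lemma border_rank_le_mm_red_tensor_lower_bound:
  assumes "n \<ge> 3" "border_rank_le n (mm_red_tensor n) r"
  shows "2 * n\<^sup>2 - n \<le> r"
proof (rule ccontr)
  assume "\<not> ?thesis"
  then have r: "r + 1 \<le> 2 * n\<^sup>2 - n" by simp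
  let ?J = "pivot_columns n"
  let ?D = "2 * n - 2 choose (n - 1)"
  \<comment> \<open>Here \<open>n \<ge> 3\<close> enters; the inequality fails at 2.\<close>
  have "n < 2 * (n - 1)" using assms(1) by simp
  also have "\<dots> = 2 * (n - 1) choose 1" by simp
  also have "\<dots> \<le> 2 * (n - 1) choose (n - 1)" by (rule binomial_maximum')
  also have "2 * (n - 1) = 2 * n - 2" by simp
  finally have "n < ?D" .
  moreover have "(r + 1) * ?D \<le> (2 * n\<^sup>2 - n) * ?D" using r by (rule mult_right_mono) simp
  ultimately have count: "r * ?D < card ?J"
    using card_pivot_columns[of n] assms(1) unfolding add_mult_distrib by linarith
  obtain u v w :: "nat \<Rightarrow> nat \<Rightarrow> idx \<Rightarrow> complex" where lim:
    "\<forall>a\<in>idxset n. \<forall>b\<in>idxset n. \<forall>c\<in>idxset n.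
      (\<lambda>m. \<Sum>l<r. u m l a * v m l b * w m l c) \<longlonglongrightarrow> mm_red_tensor n a b c"
    using assms(2) unfolding border_rank_le_def by (elim exE)
  \<comment> \<open>The projection is linear in the first factor, so it keeps every term of rank at
    most one.\<close>
  define \<tau> where "\<tau> m = (\<lambda>t \<beta> \<gamma>. \<Sum>l<r. hankel n (u m l) t * v m l \<beta> * w m l \<gamma>)" for m
  have \<tau>_lim: "(\<lambda>m. \<tau> m t \<beta> \<gamma>) \<longlonglongrightarrow> hankel n (\<lambda>a. mm_red_tensor n a \<beta> \<gamma>) t"
    if "\<beta> \<in> idxset n" "\<gamma> \<in> idxset n" for t \<beta> \<gamma>
  proof -
    have "\<tau> m t \<beta> \<gamma> = hankel n (\<lambda>a. \<Sum>l<r. u m l a * v m l \<beta> * w m l \<gamma>) t" for m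
      unfolding \<tau>_def hankel_def by (subst sum.swap) (simp add: sum_distrib_right)
    moreover have "(\<lambda>m. hankel n (\<lambda>a. \<Sum>l<r. u m l a * v m l \<beta> * w m l \<gamma>) t)
        \<longlonglongrightarrow> hankel n (\<lambda>a. mm_red_tensor n a \<beta> \<gamma>) t"
      unfolding hankel_def using that by (intro tendsto_sum lim[rule_format]) auto
    ultimately show ?thesis by simp
  qed
  let ?I = "{T. T \<subseteq> {..<2 * n - 1} \<and> card T = n} \<times> idxset n"
  have "\<exists>x. (\<exists>P\<in>?J. x P \<noteq> 0) \<and> (\<forall>R\<in>?I. (\<Sum>P\<in>?J.
      koszul (\<lambda>t \<beta> \<gamma>. hankel n (\<lambda>a. mm_red_tensor n a \<beta> \<gamma>) t) R P * x P) = 0)"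
  proof (rule nontrivial_kernel_limit[OF finite_pivot_columns])
    fix R P assume "R \<in> ?I" "P \<in> ?J"
    then have "snd P \<in> idxset n" "snd R \<in> idxset n" by (auto simp: pivot_columns_def)
    then have "(\<lambda>m. if fst P = fst R - {t} then wedge_sign (fst R) t * \<tau> m t (snd P) (snd R) else 0)
        \<longlonglongrightarrow> (if fst P = fst R - {t} then wedge_sign (fst R) t *
          hankel n (\<lambda>a. mm_red_tensor n a (snd P) (snd R)) t else 0)" for t
      by (cases "fst P = fst R - {t}") (simp_all add: tendsto_mult_left \<tau>_lim)
    then show "(\<lambda>m. koszul (\<tau> m) R P)
        \<longlonglongrightarrow> koszul (\<lambda>t \<beta> \<gamma>. hankel n (\<lambda>a. mm_red_tensor n a \<beta> \<gamma>) t) R P"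
      unfolding koszul_def by (intro tendsto_sum)
  next
    fix m
    \<comment> \<open>The parameters are \<open>N = 2 * n - 1\<close> and \<open>d = n - 1\<close>,
      so \<open>N - 1 choose d\<close> is the binomial in \<open>count\<close>.\<close>
    have n: "Suc (n - 1) = n" "2 * n - 1 > 0" "2 * n - 1 - 1 = 2 * n - 2" using assms(1) by auto
    obtain x where "\<exists>P\<in>?J. x P \<noteq> 0"
      "\<forall>R\<in>{T. T \<subseteq> {..<2 * n - 1} \<and> card T = n} \<times> UNIV. (\<Sum>P\<in>?J. koszul (\<tau> m) R P * x P) = 0"
      using koszul_rank_one_sum_kernel[OF finite_pivot_columns n(2), unfolded n, OF count,
          where U = "\<lambda>l. hankel n (u m l)" and v = "v m" and w = "w m", folded \<tau>_def]
      unfolding n by blast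
    then show "\<exists>x. (\<exists>P\<in>?J. x P \<noteq> 0) \<and> (\<forall>R\<in>?I. (\<Sum>P\<in>?J. koszul (\<tau> m) R P * x P) = 0)"
      by (intro exI[of _ x]) auto
  qed
  with koszul_mm_red_tensor_injective show False by blast
qed

text \<open>Without a finite decomposition the \<open>LEAST\<close> in \<open>border_rank\<close> would be unspecified.\<close>

lemma border_rank_le_exists: "\<exists>r. border_rank_le n T r"
proof -
  let ?I = "idxset n \<times> idxset n \<times> idxset n"
  obtain h where h: "bij_betw h {..<card ?I} ?I"
    using ex_bij_betw_nat_finite[of ?I] by (auto simp: atLeast0LessThan)
  define u where "u l a = (if a = fst (h l) then T (fst (h l)) (fst (snd (h l))) (snd (snd (h l))) else 0)"
    for l a
  define v :: "nat \<Rightarrow> idx \<Rightarrow> complex" where "v l b = (if b = fst (snd (h l)) then 1 else 0)" for l b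
  define w :: "nat \<Rightarrow> idx \<Rightarrow> complex" where "w l c = (if c = snd (snd (h l)) then 1 else 0)" for l c
  have "(\<Sum>l<card ?I. u l a * v l b * w l c) = T a b c"
    if "a \<in> idxset n" "b \<in> idxset n" "c \<in> idxset n" for a b c
  proof -
    have "(\<Sum>l<card ?I. u l a * v l b * w l c) = (\<Sum>l<card ?I. if h l = (a, b, c) then T a b c else 0)"
      by (intro sum.cong refl) (auto simp: u_def v_def w_def split: prod.splits)
    also have "\<dots> = (\<Sum>p\<in>?I. if p = (a, b, c) then T a b c else 0)"
      by (rule sum.reindex_bij_betw[OF h])
    also have "\<dots> = T a b c" using that by (subst sum.delta) auto
    finally show ?thesis .
  qed
  then have "border_rank_le n T (card ?I)"
    unfolding border_rank_le_def
    by (intro exI[of _ "\<lambda>_. u"] exI[of _ "\<lambda>_. v"] exI[of _ "\<lambda>_. w"]) simp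
  then show ?thesis ..
qed

theorem theorem6p1:
  fixes n :: nat
  assumes "n \<ge> 3"
  shows "2 * n^2 - n \<le> border_rank n (mm_red_tensor n)"
  unfolding border_rank_def
  using border_rank_le_exists by (intro border_rank_le_mm_red_tensor_lower_bound[OF assms]) (rule LeastI_ex)

end
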